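(* Let $n,k\ge 1$ be integers, let $\mathcal{H}=\bigoplus_{i=1}^n\mathcal{H}_i\cong\mathbb{C}^{nk}$ with $\mathcal{H}_i\cong\mathbb{C}^k$, and let $I,E,B,D$ be the linear maps on $\mathcal{B}(\mathcal{H})$ defined in the context. Let $a,b,c,d\in\mathbb{R}$ and $\Phi=\Phi(a,b,c,d)=aI+bE+cB+dD$. If $\Phi$ is $2$-positive, then $$2a+2b+\frac{c+d}{nk}\ge 0,\qquad c+d\ge 0,\qquad d\ge 0.$$
   Context: For $i=1,\dots,n$, $\mathcal{H}_i\cong\mathbb{C}^k$ has orthonormal basis $\{e_{i,j}: j=1,\dots,k\}$, and $I_{\mathcal{H}_i}\in\mathcal{B}(\mathcal{H})$ denotes the orthogonal projection of $\mathcal{H}=\bigoplus_{i=1}^n\mathcal{H}_i$ onto $\mathcal{H}_i$. Define linear maps on $\mathcal{B}(\mathcal{H})$ by: - $I(X)=X$ (identity map); - $E(X)=\sum_{i=1}^n I_{\mathcal{H}_i}XI_{\mathcal{H}_i}$ (conditional expectation onto block-diagonal matrices); - $B(X)=\frac1n\sum_{i=1}^n \mathrm{Tr}_{\mathcal{H}_i}(X)\,I_{\mathcal{H}_i}$, where $\mathrm{Tr}_{\mathcal{H}_i}(X)=\frac1k\sum_{j=1}^k\langle e_{i,j},Xe_{i,j}\rangle$; - $D(X)=\mathrm{Tr}(X)\,I_{\mathcal{H}}$, where $\mathrm{Tr}(X)=\frac1{nk}\sum_{i=1}^n\sum_{j=1}^k\langle e_{i,j},Xe_{i,j}\rangle$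 is the normalised trace. $\Phi$ is $2$-positive if $\mathcal{I}_2\otimes\Phi$ is a positive map on $M_2(\mathbb{C})\otimes\mathcal{B}(\mathcal{H})$, where $\mathcal{I}_2$ is the identity map on $M_2(\mathbb{C})$.
   Formalization: The first two inequalities are claimed only for k ≥ 2 and d ≥ 0 only for n ≥ 2: for k = 1, Φ(0,t,−nt,0) = 0 is 2-positive for every real t and violates the first two; for n = 1, Φ(0,0,1,−1) = 0 violates d ≥ 0. *)

theory Defs
  imports "HOL-Analysis.Analysis"
begin

text \<open>
  The space \<open>\<H>\<close>, a direct sum over \<open>'n\<close> of copies of \<open>\<complex>\<^sup>k\<close>, is rendered as
  \<open>complex ^ ('n \<times> 'k)\<close>, where \<open>'n\<close> and \<open>'k\<close> are finite types of cardinality \<open>n\<close> and \<open>k\<close>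
  (hence \<open>n, k \<ge> 1\<close>). The vector \<open>e\<^sub>i\<^sub>,\<^sub>j\<close> is the coordinate vector at \<open>(i, j)\<close>, and operators
  on \<open>\<H>\<close> are identified with their matrices in this basis.
\<close>

type_synonym ('n, 'k) operator = "complex ^ ('n \<times> 'k) ^ ('n \<times> 'k)"

definition cinner :: "complex ^ 'r \<Rightarrow> complex ^ 'r \<Rightarrow> complex"
  where "cinner v w = (\<Sum>r\<in>UNIV. cnj (v $ r) * w $ r)"

definition cscale :: "complex \<Rightarrow> complex ^ 'r ^ 's \<Rightarrow> complex ^ 'r ^ 's"
  where "cscale z X = map_matrix ((*) z) X"

definition basis_vec :: "'n \<Rightarrow> 'k \<Rightarrow> complex ^ ('n::finite \<times> 'k::finite)"
  where "basis_vec i j = axis (i, j) 1"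

definition block_proj :: "'n \<Rightarrow> ('n::finite, 'k::finite) operator"
  where "block_proj i = (\<chi> r s. if r = s \<and> fst r = i then 1 else 0)"

definition block_tr :: "'n \<Rightarrow> ('n::finite, 'k::finite) operator \<Rightarrow> complex"
  where "block_tr i X =
    (\<Sum>j\<in>UNIV. cinner (basis_vec i j) (X *v basis_vec i j)) / of_nat CARD('k)"

definition normalised_tr :: "('n::finite, 'k::finite) operator \<Rightarrow> complex"
  where "normalised_tr X =
    (\<Sum>i\<in>UNIV. \<Sum>j\<in>UNIV. cinner (basis_vec i j) (X *v basis_vec i j))
      / of_nat (CARD('n) * CARD('k))"

definition map_I :: "('n::finite, 'k::finite) operator \<Rightarrow> ('n, 'k) operator"
  where "map_I X = X"

definition map_E :: "('n::finite, 'k::finite) operator \<Rightarrow> ('n, 'k) operator"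
  where "map_E X = (\<Sum>i\<in>UNIV. block_proj i ** X ** block_proj i)"

definition map_B :: "('n::finite, 'k::finite) operator \<Rightarrow> ('n, 'k) operator"
  where "map_B X =
    cscale (1 / of_nat CARD('n)) (\<Sum>i\<in>UNIV. cscale (block_tr i X) (block_proj i))"

definition map_D :: "('n::finite, 'k::finite) operator \<Rightarrow> ('n, 'k) operator"
  where "map_D X = cscale (normalised_tr X) (mat 1)"

definition Phi ::
    "real \<Rightarrow> real \<Rightarrow> real \<Rightarrow> real \<Rightarrow> ('n::finite, 'k::finite) operator \<Rightarrow> ('n, 'k) operator"
  where "Phi a b c d X =
    a *\<^sub>R map_I X + b *\<^sub>R map_E X + c *\<^sub>R map_B X + d *\<^sub>R map_D X"

text \<open>
  The parameters are not determined by the map in the degenerate cases: if \<open>k = 1\<close> then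
  \<open>B = E / n\<close>, and if \<open>n = 1\<close> then \<open>E = I\<close> and \<open>B = D\<close>. Thus \<open>Phi 0 t (- n t) 0\<close> (for \<open>k = 1\<close>) and
  \<open>Phi 0 0 1 (- 1)\<close> (for \<open>n = 1\<close>) are the zero map, so the inequalities on
  \<open>2 a + 2 b + (c + d) / (n k)\<close> and on \<open>c + d\<close> need \<open>k \<ge> 2\<close>, and the one on \<open>d\<close> needs \<open>n \<ge> 2\<close>.
\<close>

definition positive_operator :: "complex ^ 'r ^ 'r \<Rightarrow> bool"
  where "positive_operator X \<longleftrightarrow> (\<forall>v. cinner v (X *v v) \<in> \<real>\<^sub>\<ge>\<^sub>0)"

definition positive_map :: "(complex ^ 'r::finite ^ 'r \<Rightarrow> complex ^ 's::finite ^ 's) \<Rightarrow> bool"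
  where "positive_map \<Psi> \<longleftrightarrow> (\<forall>X. positive_operator X \<longrightarrow> positive_operator (\<Psi> X))"

text \<open>
  The tensor product of \<open>m \<times> m\<close> matrices and \<open>r \<times> r\<close> matrices is identified with the matrices
  indexed by \<open>'m \<times> 'r\<close>, that is, with \<open>m \<times> m\<close> block matrices with \<open>r \<times> r\<close> blocks; the identity
  map tensored with \<open>\<Psi>\<close> then applies \<open>\<Psi>\<close> to every block.
\<close>

definition tensor_op ::
    "complex ^ 'm::finite ^ 'm \<Rightarrow> complex ^ 'r::finite ^ 'r \<Rightarrow> complex ^ ('m \<times> 'r) ^ ('m \<times> 'r)"
  where "tensor_op A X = (\<chi> r s. A $ fst r $ fst s * X $ snd r $ snd s)"

definition matrix_block ::
    "complex ^ ('m::finite \<times> 'r::finite) ^ ('m \<times> 'r) \<Rightarrow> 'm \<Rightarrow> 'm \<Rightarrow> complex ^ 'r ^ 'r"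
  where "matrix_block Y p q = (\<chi> x y. Y $ (p, x) $ (q, y))"

definition id_tensor ::
    "(complex ^ 'r::finite ^ 'r \<Rightarrow> complex ^ 's::finite ^ 's) \<Rightarrow>
      complex ^ ('m::finite \<times> 'r) ^ ('m \<times> 'r) \<Rightarrow> complex ^ ('m \<times> 's) ^ ('m \<times> 's)"
  where "id_tensor \<Psi> Y =
    (\<chi> r s. \<Psi> (matrix_block Y (fst r) (fst s)) $ snd r $ snd s)"

lemma id_tensor_tensor_op:
  assumes "\<And>z X. \<Psi> (cscale z X) = cscale z (\<Psi> X)"
  shows "id_tensor \<Psi> (tensor_op A X) = tensor_op A (\<Psi> X)"
proof -
  have "matrix_block (tensor_op A X) p q = cscale (A $ p $ q) X" for p q
    by (simp add: matrix_block_def tensor_op_def cscale_def vec_eq_iff)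
  then show ?thesis
    unfolding id_tensor_def by (simp add: assms) (simp add: tensor_op_def cscale_def)
qed

definition two_positive :: "(complex ^ 'r::finite ^ 'r \<Rightarrow> complex ^ 's::finite ^ 's) \<Rightarrow> bool"
  where "two_positive \<Psi> \<longleftrightarrow>
    positive_map (id_tensor \<Psi> :: complex ^ (2 \<times> 'r) ^ (2 \<times> 'r) \<Rightarrow> complex ^ (2 \<times> 's) ^ (2 \<times> 's))"

end

theory Submission
  imports Defs
begin

text \<open>
  A matrix of the form \<open>\<psi> \<psi>\<^sup>*\<close> is positive, so \<open>2\<close>-positivity of a map \<open>\<Psi>\<close> makes
  \<open>\<langle>\<phi>, (\<I>\<^sub>2 \<otimes> \<Psi>)(\<psi> \<psi>\<^sup>*) \<phi>\<rangle>\<close> nonnegative for all vectors \<open>\<psi>\<close> and \<open>\<phi>\<close>. It suffices to use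
  the vectors \<open>\<psi> = \<Sum>\<^sub>p e\<^sub>p \<otimes> e\<^bsub>u p\<^esub>\<close> and \<open>\<phi> = \<Sum>\<^sub>p e\<^sub>p \<otimes> e\<^bsub>w p\<^esub>\<close>, where \<open>u\<close> and \<open>w\<close> assign a
  coordinate of \<open>\<H>\<close> to each of the two values of \<open>p\<close>. The quantity then is the sum over
  \<open>p, q\<close> of the \<open>(w p, w q)\<close> entry of the image under \<open>\<Psi>\<close> of a matrix unit
  (\<open>sum_matrix_unit_entries_nonneg\<close>), and such an entry is explicit for \<open>\<Psi> = \<Phi>(a,b,c,d)\<close>
  (\<open>Phi_matrix_unit\<close>).

  For \<open>u = w\<close> with the two distinct values \<open>(i, j)\<close> and \<open>(i, j')\<close> in one block, \<open>I\<close> and \<open>E\<close>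
  contribute to all four terms, but \<open>B\<close> and \<open>D\<close> only to the two with \<open>p = q\<close>, because an
  off-diagonal matrix unit has trace zero. The sum is \<open>4 (a + b) + 2 (c + d) / (n k)\<close>.
  For constant \<open>u\<close> and \<open>w\<close> with different values, \<open>I\<close> and \<open>E\<close> drop out; what remains is
  \<open>4 (c + d) / (n k)\<close> if the two values lie in one block, and \<open>4 d / (n k)\<close> otherwise.
\<close>

definition matrix_unit :: "'r \<Rightarrow> 'r \<Rightarrow> complex ^ 'r ^ 'r"
  where "matrix_unit x y = (\<chi> r s. if r = x \<and> s = y then 1 else 0)"

lemma cinner_matrix_vector:
  fixes X :: "complex ^ 'r::finite ^ 'r"
  shows "cinner v (X *v v) = (\<Sum>r\<in>UNIV. \<Sum>s\<in>UNIV. cnj (v $ r) * X $ r $ s * v $ s)"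
  by (simp add: cinner_def matrix_vector_mult_def sum_distrib_left mult.assoc)

text \<open>For real \<open>f\<close> the matrix below is \<open>f f\<^sup>*\<close>, and \<open>\<langle>v, f f\<^sup>* v\<rangle> = \<bar>\<langle>f, v\<rangle>\<bar>\<^sup>2\<close>.\<close>

lemma positive_operator_rank_one:
  fixes f :: "'r::finite \<Rightarrow> real"
  shows "positive_operator (\<chi> r s. complex_of_real (f r * f s))"
  unfolding positive_operator_def
proof
  fix v :: "complex ^ 'r"
  let ?S = "\<Sum>s\<in>UNIV. of_real (f s) * v $ s"
  have "cinner v ((\<chi> r s. complex_of_real (f r * f s)) *v v) = cnj ?S * ?S"
    unfolding cinner_matrix_vector cnj_sum sum_product by (simp add: mult_ac)
  also have "\<dots> = of_real ((cmod ?S)\<^sup>2)"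
    unfolding complex_norm_square by (rule mult.commute)
  finally show "cinner v ((\<chi> r s. complex_of_real (f r * f s)) *v v) \<in> \<real>\<^sub>\<ge>\<^sub>0"
    by (simp only: nonneg_Reals_of_real_iff zero_le_power2)
qed

lemma sum_graph:
  fixes g :: "'m::finite \<times> 'r::finite \<Rightarrow> complex"
  shows "(\<Sum>r\<in>UNIV. if snd r = w (fst r) then g r else 0) = (\<Sum>p\<in>UNIV. g (p, w p))"
proof -
  have "(\<Sum>r\<in>UNIV. if snd r = w (fst r) then g r else 0)
      = (\<Sum>p\<in>UNIV. \<Sum>x\<in>UNIV. if x = w p then g (p, x) else 0)"
    unfolding sum.cartesian_product UNIV_Times_UNIV by (intro sum.cong) auto
  then show ?thesis
    by simp
qed

text \<open>
  The \<open>(p, q)\<close> block of \<open>\<psi> \<psi>\<^sup>*\<close> for \<open>\<psi> = \<Sum>\<^sub>p e\<^sub>p \<otimes> e\<^bsub>u p\<^esub>\<close> is the matrix unit at \<open>(u p, u q)\<close>,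
  and testing against \<open>\<Sum>\<^sub>p e\<^sub>p \<otimes> e\<^bsub>w p\<^esub>\<close> picks one entry from the image of each block.
\<close>

lemma sum_matrix_unit_entries_nonneg:
  fixes \<Psi> :: "complex ^ 'r::finite ^ 'r \<Rightarrow> complex ^ 's::finite ^ 's"
    and u :: "'m::finite \<Rightarrow> 'r" and w :: "'m \<Rightarrow> 's"
  assumes "positive_map
    (id_tensor \<Psi> :: complex ^ ('m \<times> 'r) ^ ('m \<times> 'r) \<Rightarrow> complex ^ ('m \<times> 's) ^ ('m \<times> 's))"
  shows "(\<Sum>p\<in>UNIV. \<Sum>q\<in>UNIV. \<Psi> (matrix_unit (u p) (u q)) $ w p $ w q) \<in> \<real>\<^sub>\<ge>\<^sub>0"
proof -
  define f :: "'m \<times> 'r \<Rightarrow> real" where "f r = (if snd r = u (fst r) then 1 else 0)" for r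
  define Y :: "complex ^ ('m \<times> 'r) ^ ('m \<times> 'r)"
    where "Y = (\<chi> r s. complex_of_real (f r * f s))"
  define \<phi> :: "complex ^ ('m \<times> 's)"
    where "\<phi> = (\<chi> r. if snd r = w (fst r) then 1 else 0)"
  have block: "matrix_block Y p q = matrix_unit (u p) (u q)" for p q
    by (auto simp: matrix_block_def matrix_unit_def Y_def f_def vec_eq_iff)
  have "positive_operator (id_tensor \<Psi> Y)"
    using assms positive_operator_rank_one[of f] by (simp add: positive_map_def Y_def)
  then have "cinner \<phi> (id_tensor \<Psi> Y *v \<phi>) \<in> \<real>\<^sub>\<ge>\<^sub>0"
    by (simp add: positive_operator_def)
  also have "cinner \<phi> (id_tensor \<Psi> Y *v \<phi>)
      = (\<Sum>r\<in>UNIV. if snd r = w (fst r) then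
          (\<Sum>s\<in>UNIV. if snd s = w (fst s) then id_tensor \<Psi> Y $ r $ s else 0) else 0)"
    unfolding cinner_matrix_vector by (rule sum.cong) (auto simp: \<phi>_def intro!: sum.cong)
  finally show ?thesis
    unfolding sum_graph sum_graph[of w "\<lambda>r. \<Sum>q\<in>UNIV. id_tensor \<Psi> Y $ r $ (q, w q)"]
    by (simp add: id_tensor_def block)
qed

lemma cinner_basis_vec:
  fixes X :: "('n::finite, 'k::finite) operator"
  shows "cinner (basis_vec i j) (X *v basis_vec i j) = X $ (i, j) $ (i, j)"
proof -
  have "(X *v basis_vec i j) $ r = (\<Sum>s\<in>UNIV. if s = (i, j) then X $ r $ s else 0)" for r
    unfolding matrix_vector_mult_def vec_lambda_beta
    by (rule sum.cong) (auto simp: basis_vec_def axis_def)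
  then have column: "(X *v basis_vec i j) $ r = X $ r $ (i, j)" for r
    by simp
  have "cinner (basis_vec i j) (X *v basis_vec i j)
      = (\<Sum>r\<in>UNIV. if r = (i, j) then X $ r $ (i, j) else 0)"
    unfolding cinner_def column by (rule sum.cong) (auto simp: basis_vec_def axis_def)
  then show ?thesis
    by simp
qed

lemma map_E_nth:
  fixes X :: "('n::finite, 'k::finite) operator"
  shows "map_E X $ r $ s = (if fst r = fst s then X $ r $ s else 0)"
proof -
  have left: "(block_proj i ** Y) $ r $ s = (if fst r = i then Y $ r $ s else 0)"
    for i and Y :: "('n, 'k) operator"
  proof -
    have "(block_proj i ** Y) $ r $ s
        = (\<Sum>t\<in>UNIV. if t = r then (if fst r = i then Y $ t $ s else 0) else 0)"
      unfolding matrix_matrix_mult_def vec_lambda_beta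
      by (rule sum.cong) (auto simp: block_proj_def)
    then show ?thesis
      by simp
  qed
  have right: "(Y ** block_proj i) $ r $ s = (if fst s = i then Y $ r $ s else 0)"
    for i and Y :: "('n, 'k) operator"
  proof -
    have "(Y ** block_proj i) $ r $ s
        = (\<Sum>t\<in>UNIV. if t = s then (if fst s = i then Y $ r $ t else 0) else 0)"
      unfolding matrix_matrix_mult_def vec_lambda_beta
      by (rule sum.cong) (auto simp: block_proj_def)
    then show ?thesis
      by simp
  qed
  have "map_E X $ r $ s
      = (\<Sum>i\<in>UNIV. if i = fst s then (if fst r = fst s then X $ r $ s else 0) else 0)"
    unfolding map_E_def sum_component right left by (rule sum.cong) auto
  then show ?thesis
    by simp
qed

lemma map_B_nth:
  fixes X :: "('n::finite, 'k::finite) operator"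
  shows "map_B X $ r $ s =
    (if r = s then (\<Sum>j\<in>UNIV. X $ (fst r, j) $ (fst r, j)) / of_nat (CARD('n) * CARD('k)) else 0)"
proof -
  have "map_B X $ r $ s
      = (\<Sum>i\<in>UNIV. cscale (block_tr i X) (block_proj i) $ r $ s) / of_nat CARD('n)"
    by (simp add: map_B_def cscale_def)
  also have "(\<Sum>i\<in>UNIV. cscale (block_tr i X) (block_proj i) $ r $ s)
      = (\<Sum>i\<in>UNIV. if i = fst r then (if r = s then block_tr i X else 0) else 0)"
    by (rule sum.cong) (auto simp: cscale_def block_proj_def)
  finally show ?thesis
    by (simp add: block_tr_def cinner_basis_vec mult.commute)
qed

lemma map_D_nth:
  fixes X :: "('n::finite, 'k::finite) operator"
  shows "map_D X $ r $ s =
    (if r = s then (\<Sum>i\<in>UNIV. \<Sum>j\<in>UNIV. X $ (i, j) $ (i, j)) / of_nat (CARD('n) * CARD('k)) else 0)"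
  by (simp add: map_D_def cscale_def mat_def normalised_tr_def cinner_basis_vec)

text \<open>
  Inside the block \<open>i\<close> the maps \<open>I\<close> and \<open>E\<close> both fix the matrix unit. Its trace is \<open>1\<close> or
  \<open>0\<close> according to \<open>j = j'\<close>, and \<open>B\<close> spreads it over the diagonal of that block only, whereas
  \<open>D\<close> spreads it over the whole diagonal.
\<close>

lemma Phi_matrix_unit:
  fixes i :: "'n::finite" and j j' :: "'k::finite"
  shows "Phi a b c d (matrix_unit (i, j) (i, j')) $ r $ s =
    complex_of_real ((if r = (i, j) \<and> s = (i, j') then a + b else 0)
      + (if j = j' \<and> r = s then ((if fst r = i then c else 0) + d)
          / (real CARD('n) * real CARD('k)) else 0))"
proof -
  have block_trace: "(\<Sum>l\<in>UNIV. matrix_unit (i, j) (i, j') $ (m, l) $ (m, l))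
      = (if m = i \<and> j = j' then 1 else 0)" for m
  proof -
    have "(\<Sum>l\<in>UNIV. matrix_unit (i, j) (i, j') $ (m, l) $ (m, l))
        = (\<Sum>l\<in>UNIV. if l = j then (if m = i \<and> j = j' then 1 else 0) else 0)"
      by (rule sum.cong) (auto simp: matrix_unit_def)
    then show ?thesis
      by simp
  qed
  have "(\<Sum>m\<in>UNIV. if m = i \<and> j = j' then 1 else 0) = (if j = j' then 1 else 0 :: complex)"
    by (cases "j = j'") simp_all
  then have "Phi a b c d (matrix_unit (i, j) (i, j')) $ r $ s =
      a *\<^sub>R matrix_unit (i, j) (i, j') $ r $ s
      + b *\<^sub>R (if fst r = fst s then matrix_unit (i, j) (i, j') $ r $ s else 0)
      + c *\<^sub>R (if r = s then (if fst r = i \<and> j = j' then 1 else 0)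
          / of_nat (CARD('n) * CARD('k)) else 0)
      + d *\<^sub>R (if r = s then (if j = j' then 1 else 0) / of_nat (CARD('n) * CARD('k)) else 0)"
    by (simp add: Phi_def map_I_def map_E_nth map_B_nth map_D_nth block_trace)
  then show ?thesis
    by (auto simp: matrix_unit_def scaleR_conv_of_real add_divide_distrib)
qed

lemma ex_distinct_pair:
  assumes "2 \<le> CARD('a::finite)"
  obtains x y :: "'a::finite" where "x \<noteq> y"
  using obtain_subset_with_card_n[OF assms] card_2_iff by metis

theorem theorem3p2:
  fixes a b c d :: real
  assumes "two_positive
    (Phi a b c d :: ('n::finite, 'k::finite) operator \<Rightarrow> ('n, 'k) operator)"
  shows "(2 \<le> CARD('k) \<longrightarrow>
            2 * a + 2 * b + (c + d) / (real CARD('n) * real CARD('k)) \<ge> 0)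
       \<and> (2 \<le> CARD('k) \<longrightarrow> c + d \<ge> 0)
       \<and> (2 \<le> CARD('n) \<longrightarrow> d \<ge> 0)"
proof -
  let ?\<Phi> = "Phi a b c d :: ('n, 'k) operator \<Rightarrow> ('n, 'k) operator"
  let ?N = "real CARD('n) * real CARD('k)"
  have N: "0 < ?N"
    by simp
  have nonneg: "(\<Sum>p\<in>UNIV. \<Sum>q\<in>UNIV. ?\<Phi> (matrix_unit (u p) (u q)) $ w p $ w q) \<in> \<real>\<^sub>\<ge>\<^sub>0"
    for u w :: "2 \<Rightarrow> 'n \<times> 'k"
    using assms unfolding two_positive_def by (rule sum_matrix_unit_entries_nonneg)
  have diagonal: "0 \<le> ((if m = i then c else 0) + d)" if "(m, l) \<noteq> (i, j)"
    for i m :: 'n and j l :: 'k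
  proof -
    \<comment> \<open>For constant \<open>u\<close> and \<open>w\<close> the four pairs \<open>(p, q)\<close> contribute the same entry.\<close>
    have "complex_of_real (4 * (((if m = i then c else 0) + d) / ?N)) \<in> \<real>\<^sub>\<ge>\<^sub>0"
      using nonneg[of "\<lambda>_. (i, j)" "\<lambda>_. (m, l)"] that
      by (simp add: Phi_matrix_unit split: if_splits)
    then have "0 \<le> 4 * (((if m = i then c else 0) + d) / ?N)"
      by (simp only: nonneg_Reals_of_real_iff)
    then show ?thesis
      using N by (simp add: zero_le_divide_iff del: of_nat_mult split: if_splits)
  qed
  have "0 \<le> 2 * a + 2 * b + (c + d) / ?N" and "0 \<le> c + d" if "2 \<le> CARD('k)"
  proof -
    obtain j j' :: 'k where j: "j \<noteq> j'"
      using ex_distinct_pair[OF \<open>2 \<le> CARD('k)\<close>] .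
    fix i :: 'n
    let ?u = "\<lambda>p :: 2. (i, if p = 1 then j else j')"
    have "(\<Sum>p\<in>UNIV. \<Sum>q\<in>UNIV. ?\<Phi> (matrix_unit (?u p) (?u q)) $ ?u p $ ?u q)
        = complex_of_real (2 * (2 * a + 2 * b + (c + d) / ?N))"
      using j by (simp add: Phi_matrix_unit sum_2)
    with nonneg[of ?u ?u] have "0 \<le> 2 * (2 * a + 2 * b + (c + d) / ?N)"
      by (simp only: nonneg_Reals_of_real_iff)
    then show "0 \<le> 2 * a + 2 * b + (c + d) / ?N"
      by (simp only: zero_le_mult_iff) simp
    show "0 \<le> c + d"
      using diagonal[of i j' i j] j by simp
  qed
  moreover have "0 \<le> d" if "2 \<le> CARD('n)"
  proof -
    obtain i m :: 'n where "m \<noteq> i"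
      using ex_distinct_pair[OF \<open>2 \<le> CARD('n)\<close>] .
    then show ?thesis
      using diagonal[of m undefined i undefined] by simp
  qed
  ultimately show ?thesis
    by blast
qed

end
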